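(* Let $d>1$ be an integer, let $p,q\geq 1$ be integers with $\frac{p}{q}$ in lowest terms, and let $k\geq 1$ be an integer. Let $\mathcal{B}$ be the collection of all rotational sets for $\sigma_d$ that contain $k$ (distinct) orbits and have rotation number $\frac{p}{q}$. Then $$|\mathcal{B}| = \sum_{i=k-1}^{l} \left[ \binom{d+q-2}{d-2-i} \sum_{j=0}^{k-1} \left[ (-1)^j \binom{k-1}{j} \binom{q(k-1-j)}{i} \right] \right],$$ where $$l = \begin{cases} q(k-1) & \text{if } d-2 > q(k-1),\\ d-2 & \text{otherwise.}\end{cases}$$
   Context: The circle $S^1$ is coordinatized by $[0,1)$, i.e. points are central angles measured in revolutions modulo $1$. For an integer $d>1$, the angle $d$-tupling map is $\sigma_d:S^1\to S^1$, $\sigma_d(x)=dx \pmod 1$. The orbit of a point $x$ is $\{\sigma_d^n(x)\}_{n=0}^{\infty}$. Rotational set: let $\mathcal{P}=\{x_i \mid 0\leq x_1<x_2<\dots<x_{qk}<1\}$ be a finite set of $qk$ points listed in consecutive counterclockwise order in $S^1$; indices are taken modulo $qk$ with representatives in $\{1,\dots,qk\}$. $\mathcal{P}$ is a rotational set containing $k$ orbits with rotation number $\frac{p}{q}$ for $\sigma_d$ if and only if: (1) $\sigma_d(\mathcal{P})=\mathcal{P}$; (2) for every $i\in\{1,\dots,qk\}$, the points $x_i,x_{i+1},\dots,x_{i+k-1}$ (indices mod $qk$) are in (pairwise) different orbits; (3) $\sigma_d(x_i)=x_{i+pk}$ (index mod $qk$) for every $i$. Conventions: for integers $n,m\ge 0$,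 $\binom{n}{m}$ is the usual binomial coefficient, with $\binom{n}{m}=0$ when $m>n$ and $\binom{0}{0}=1$; a sum whose upper limit is smaller than its lower limit is $0$. *)

theory Defs
  imports Complex_Main
begin

text \<open>Points of the circle are represented by their coordinates in \<open>{0..<1}\<close>.\<close>

definition sigma :: "nat \<Rightarrow> real \<Rightarrow> real" where
  "sigma d x = frac (real d * x)"

definition orbit :: "nat \<Rightarrow> real \<Rightarrow> real set" where
  "orbit d x = range (\<lambda>n. (sigma d ^^ n) x)"

text \<open>
  The points are enumerated as \<open>x 0 < \<dots> < x (q * k - 1)\<close>, so that indices are taken
  modulo \<open>q * k\<close> with representatives in \<open>{..<q * k}\<close> instead of \<open>{1..q * k}\<close>.
\<close>

definition rotational_set :: "nat \<Rightarrow> nat \<Rightarrow> nat \<Rightarrow> nat \<Rightarrow> real set \<Rightarrow> bool" where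
  "rotational_set d p q k P \<longleftrightarrow>
     finite P \<and> P \<subseteq> {0..<1} \<and> card P = q * k \<and>
     (let x = (\<lambda>i. sorted_list_of_set P ! (i mod (q * k))) in
        sigma d ` P = P \<and>
        (\<forall>i<q * k. \<forall>a<k. \<forall>b<k. a \<noteq> b \<longrightarrow> orbit d (x (i + a)) \<noteq> orbit d (x (i + b))) \<and>
        (\<forall>i<q * k. sigma d (x i) = x (i + p * k)))"

end

theory Submission
  imports Defs "HOL-Library.Multiset" "HOL-Library.Disjoint_Sets"
    "HOL-Computational_Algebra.Polynomial" "HOL-Number_Theory.Cong"
begin

text \<open>
  Put \<open>n = q * k\<close> and, after reducing \<open>p\<close> modulo \<open>q\<close>, \<open>m = p * k < n\<close>.  The points of a rotational set,
  continued around the circle by \<open>X (j + n) = X j + 1\<close>, form a strictly increasing sequence \<open>X\<close> of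
  reals with \<open>d * X j = X (j + m) + C j\<close> for integers \<open>C j\<close>.  Multiplication by \<open>d\<close> expands, so the
  integers \<open>C\<close> determine \<open>X\<close>: \<open>q\<close> steps of size \<open>m\<close> make \<open>p\<close> full turns, hence iterating the
  recurrence \<open>q\<close> times yields the closed formula of \<open>orbit_sum_of_solution\<close>.

  Which \<open>C\<close> occur?  The gaps \<open>Y j = X (j + 1) - X j\<close> satisfy the same recurrence with \<open>C\<close> replaced by
  its increments \<open>E j = C (j + 1) - C j\<close>.  As \<open>0 < Y j \<le> 1\<close>, the increments are greater than \<open>-1\<close>,
  that is, nonnegative.  Conversely, if \<open>E \<ge> 0\<close>, the closed formula shows that \<open>Y j > 0\<close> if and only if
  \<open>E\<close> is positive somewhere on the orbit of \<open>j\<close> under \<open>j \<mapsto> j + m\<close>, which is the residue class of \<open>j\<close>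
  modulo \<open>k\<close> because \<open>p\<close> and \<open>q\<close> are coprime (\<open>gap_pos_iff\<close>).  Finally, \<open>X 0 \<ge> 0\<close> and \<open>X (n - 1) < 1\<close>
  amount to \<open>C 0 \<ge> 0\<close> and \<open>C (n - 1) \<le> d - 2\<close>.  The last inequality makes the increment from \<open>n - 1\<close> to
  \<open>n\<close> positive, so the class of \<open>k - 1\<close> imposes no further condition.

  Thus rotational sets correspond to weakly increasing sequences
  \<open>0 \<le> C 0 \<le> \<dots> \<le> C (n - 1) \<le> d - 2\<close> with a strict ascent in each of the first \<open>k - 1\<close> residue classes.
  Such a sequence records where its \<open>d - 2\<close> unit jumps happen, the jumps missing at the end being
  placed at \<open>n\<close>.  So it is a multiset of size \<open>d - 2\<close> over the \<open>n + 1\<close> places \<open>0, \<dots>, n\<close> that meets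
  \<open>k - 1\<close> disjoint blocks of \<open>q\<close> places each.  Inclusion-exclusion over the missed blocks
  (\<open>card_multisets_hitting_blocks\<close>) counts these multisets by an alternating sum of the numbers
  \<open>(d + q - 2 + q * (k - 1 - j)) choose (d - 2)\<close>, and Vandermonde's identity expands each of them
  into the stated double sum (\<open>alternating_sum_vandermonde\<close>).
\<close>

section \<open>Multisets that meet prescribed blocks\<close>

text \<open>
  The indicator of avoiding every \<open>Q a\<close> is the product of the factors \<open>1 - [Q a g]\<close>; expanding this product
  gives the alternating sum pointwise, before summing over \<open>g\<close>.
\<close>

lemma card_avoiding_inclusion_exclusion:
  fixes Q :: "'b \<Rightarrow> 'a \<Rightarrow> bool"
  assumes "finite S" "finite I"
  shows "int (card {g \<in> S. \<forall>a\<in>I. \<not> Q a g}) =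
         (\<Sum>J\<in>Pow I. (- 1) ^ card J * int (card {g \<in> S. \<forall>a\<in>J. Q a g}))"
proof -
  have prod_indicator: "(\<Prod>a\<in>J. of_bool (R a)) = (of_bool (\<forall>a\<in>J. R a) :: int)"
    if "finite J" for J :: "'b set" and R
    using that by (induction J rule: finite_induct) auto
  have "int (card {g \<in> S. \<forall>a\<in>I. \<not> Q a g}) = (\<Sum>g\<in>S. of_bool (\<forall>a\<in>I. \<not> Q a g))"
    using assms(1) by (simp add: Int_def)
  also have "\<dots> = (\<Sum>g\<in>S. \<Prod>a\<in>I. 1 - of_bool (Q a g))"
    unfolding prod_indicator[OF assms(2), symmetric] by (simp add: of_bool_not_iff)
  also have "\<dots> = (\<Sum>g\<in>S. \<Sum>J\<in>Pow I. (- 1) ^ card J * of_bool (\<forall>a\<in>J. Q a g))"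
  proof (intro sum.cong refl)
    fix g
    have "(\<Prod>a\<in>I. 1 - of_bool (Q a g)) =
          (\<Sum>J\<in>Pow I. (- 1) ^ card J * (\<Prod>a\<in>J. of_bool (Q a g)) * (\<Prod>a\<in>I - J. 1 :: int))"
      by (rule prod_diff_conv_sum[OF assms(2)])
    also have "\<dots> = (\<Sum>J\<in>Pow I. (- 1) ^ card J * of_bool (\<forall>a\<in>J. Q a g))"
      by (intro sum.cong refl) (use assms(2) in \<open>auto simp: prod_indicator finite_subset\<close>)
    finally show "(\<Prod>a\<in>I. 1 - of_bool (Q a g)) =
          (\<Sum>J\<in>Pow I. (- 1) ^ card J * (of_bool (\<forall>a\<in>J. Q a g) :: int))" .
  qed
  also have "\<dots> = (\<Sum>J\<in>Pow I. (- 1) ^ card J * (\<Sum>g\<in>S. of_bool (\<forall>a\<in>J. Q a g)))"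
    by (subst sum.swap) (simp add: sum_distrib_left)
  also have "\<dots> = (\<Sum>J\<in>Pow I. (- 1) ^ card J * int (card {g \<in> S. \<forall>a\<in>J. Q a g}))"
    using assms(1) by (simp add: Int_def)
  finally show ?thesis .
qed

lemma sum_Pow_by_card:
  fixes f :: "nat \<Rightarrow> int"
  assumes "finite I"
  shows "(\<Sum>J\<in>Pow I. f (card J)) = (\<Sum>j\<le>card I. int (card I choose j) * f j)"
proof -
  have "(\<Sum>J\<in>Pow I. f (card J)) = (\<Sum>j\<le>card I. \<Sum>J\<in>{J\<in>Pow I. card J = j}. f (card J))"
    by (rule sum.group[symmetric]) (use assms in \<open>auto intro: card_mono\<close>)
  also have "\<dots> = (\<Sum>j\<le>card I. int (card I choose j) * f j)"
    by (intro sum.cong refl) (use assms n_subsets[of I] in auto)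
  finally show ?thesis .
qed

text \<open>
  Inclusion-exclusion over the set \<open>J\<close> of missed blocks: a multiset that misses them is an arbitrary
  multiset over the remaining \<open>card V - q * card J\<close> points.
\<close>

lemma card_multisets_hitting_blocks:
  fixes V :: "'a set" and B :: "'b \<Rightarrow> 'a set"
  assumes "finite V" "finite I"
    and block: "\<And>a. a \<in> I \<Longrightarrow> B a \<subseteq> V" "\<And>a. a \<in> I \<Longrightarrow> card (B a) = q"
    and disjoint: "disjoint_family_on B I"
  shows "int (card {g \<in> multisets_of_size V M. \<forall>a\<in>I. \<exists>v\<in>B a. v \<in># g}) =
         (\<Sum>j\<le>card I. (- 1) ^ j * int (card I choose j) * int ((card V - q * j + M - 1) choose M))"
proof -
  have count: "card {g \<in> multisets_of_size V M. \<forall>a\<in>J. \<forall>v\<in>B a. v \<notin># g} =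
               (card V - q * card J + M - 1) choose M" if "J \<subseteq> I" for J
  proof -
    have fin: "finite J" "\<And>a. a \<in> J \<Longrightarrow> finite (B a)"
      using that assms(1,2) block(1) by (auto intro: finite_subset)
    have "card (\<Union>a\<in>J. B a) = (\<Sum>a\<in>J. card (B a))"
      using disjoint that fin by (intro card_UN_disjoint) (auto simp: disjoint_family_on_def)
    also have "\<dots> = q * card J"
      using that block(2) by (simp add: subset_iff)
    finally have "card (V - (\<Union>a\<in>J. B a)) = card V - q * card J"
      using that block(1) fin by (subst card_Diff_subset) auto
    moreover have "{g \<in> multisets_of_size V M. \<forall>a\<in>J. \<forall>v\<in>B a. v \<notin># g} =
                   multisets_of_size (V - (\<Union>a\<in>J. B a)) M"
      by (auto simp: multisets_of_size_def)
    ultimately show ?thesis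
      using assms(1) by (simp add: card_multisets_of_size)
  qed
  have "int (card {g \<in> multisets_of_size V M. \<forall>a\<in>I. \<exists>v\<in>B a. v \<in># g}) =
        int (card {g \<in> multisets_of_size V M. \<forall>a\<in>I. \<not> (\<forall>v\<in>B a. v \<notin># g)})"
    by simp
  also have "\<dots> = (\<Sum>J\<in>Pow I. (- 1) ^ card J *
                 int (card {g \<in> multisets_of_size V M. \<forall>a\<in>J. \<forall>v\<in>B a. v \<notin># g}))"
    using assms(1,2) by (intro card_avoiding_inclusion_exclusion) auto
  also have "\<dots> = (\<Sum>J\<in>Pow I. (- 1) ^ card J * int ((card V - q * card J + M - 1) choose M))"
    by (intro sum.cong refl) (use count in auto)
  also have "\<dots> = (\<Sum>j\<le>card I. int (card I choose j) *
                 ((- 1) ^ j * int ((card V - q * j + M - 1) choose M)))"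
    by (rule sum_Pow_by_card[OF assms(2)])
  finally show ?thesis
    by (simp add: mult_ac)
qed

section \<open>The alternating binomial sum\<close>

lemma coeff_one_plus_X_power: "coeff ([:1, 1:] ^ a :: int poly) i = int (a choose i)"
proof (cases "i \<le> a")
  case True
  then show ?thesis by (simp add: coeff_linear_poly_power)
next
  case False
  then show ?thesis
    by (simp add: coeff_eq_0 degree_power_eq)
qed

text \<open>
  The sum is the coefficient of \<open>X ^ i\<close> in \<open>((1 + X) ^ q - 1) ^ r\<close>, and the polynomial \<open>(1 + X) ^ q - 1\<close>
  is divisible by \<open>X\<close>.
\<close>

lemma alternating_binomial_sum_eq_0:
  assumes "i < r"
  shows "(\<Sum>j\<le>r. (- 1) ^ j * int (r choose j) * int ((q * (r - j)) choose i)) = 0"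
proof -
  define u where "u = ([:1, 1:] ^ q :: int poly)"
  have "poly (u - 1) 0 = 0"
    by (simp add: u_def)
  then have "[:0, 1:] dvd u - 1"
    using poly_eq_0_iff_dvd[of "u - 1" 0] by (simp del: poly_diff)
  then have "monom 1 r dvd (u - 1) ^ r"
    using dvd_power_same[of "[:0, 1:]" "u - 1" r] by (simp add: monom_altdef)
  then have "coeff ((u - 1) ^ r) i = 0"
    using assms by (simp add: monom_1_dvd_iff')
  also have "(u - 1) ^ r = (- 1 + u) ^ r"
    by simp
  also have "\<dots> = (\<Sum>j\<le>r. of_nat (r choose j) * (- 1) ^ j * [:1, 1:] ^ (q * (r - j)))"
    unfolding binomial_ring u_def power_mult ..
  also have "coeff \<dots> i = (\<Sum>j\<le>r. (- 1) ^ j * int (r choose j) * int ((q * (r - j)) choose i))"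
    unfolding coeff_sum
  proof (intro sum.cong refl)
    fix j
    have "of_nat (r choose j) * (- 1) ^ j * [:1, 1:] ^ (q * (r - j)) =
          smult ((- 1) ^ j * int (r choose j)) ([:1, 1:] ^ (q * (r - j)))"
      by (cases "even j") (simp_all add: of_nat_poly)
    then show "coeff (of_nat (r choose j) * (- 1) ^ j * [:1, 1:] ^ (q * (r - j))) i =
               (- 1) ^ j * int (r choose j) * int ((q * (r - j)) choose i)"
      by (simp add: coeff_one_plus_X_power)
  qed
  finally show ?thesis by simp
qed

text \<open>
  Vandermonde's identity, applied to each upper index \<open>N + q * (r - j)\<close>, produces a sum over all
  \<open>i \<le> M\<close>.  The range shrinks because the inner sum vanishes outside \<open>{r..q * r}\<close>: below \<open>r\<close> by
  cancellation, above \<open>q * r\<close> term by term.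
\<close>

lemma alternating_sum_vandermonde:
  "(\<Sum>j\<le>r. (- 1) ^ j * int (r choose j) * int ((N + q * (r - j)) choose M)) =
   (\<Sum>i = r..min (q * r) M. int (N choose (M - i)) *
      (\<Sum>j\<le>r. (- 1) ^ j * int (r choose j) * int ((q * (r - j)) choose i)))"
proof -
  have "(\<Sum>j\<le>r. (- 1) ^ j * int (r choose j) * int ((N + q * (r - j)) choose M)) =
        (\<Sum>j\<le>r. (- 1) ^ j * int (r choose j) *
           (\<Sum>i\<le>M. int ((q * (r - j)) choose i) * int (N choose (M - i))))"
    by (subst add.commute) (simp add: vandermonde[symmetric])
  also have "\<dots> = (\<Sum>i\<le>M. int (N choose (M - i)) *
      (\<Sum>j\<le>r. (- 1) ^ j * int (r choose j) * int ((q * (r - j)) choose i)))"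
    unfolding sum_distrib_left by (subst sum.swap) (simp add: mult_ac)
  also have "\<dots> = (\<Sum>i = r..min (q * r) M. int (N choose (M - i)) *
      (\<Sum>j\<le>r. (- 1) ^ j * int (r choose j) * int ((q * (r - j)) choose i)))"
  proof (rule sum.mono_neutral_right)
    show "\<forall>i\<in>{..M} - {r..min (q * r) M}. int (N choose (M - i)) *
      (\<Sum>j\<le>r. (- 1) ^ j * int (r choose j) * int ((q * (r - j)) choose i)) = 0"
    proof
      fix i assume "i \<in> {..M} - {r..min (q * r) M}"
      then consider "i < r" | "i > q * r" by fastforce
      then have "(\<Sum>j\<le>r. (- 1) ^ j * int (r choose j) * int ((q * (r - j)) choose i)) = 0"
      proof cases
        case 2
        have "q * (r - j) < i" for j
          using 2 by (meson diff_le_self le_less_trans mult_le_mono2)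
        then show ?thesis by (simp add: binomial_eq_0)
      qed (rule alternating_binomial_sum_eq_0)
      then show "int (N choose (M - i)) *
        (\<Sum>j\<le>r. (- 1) ^ j * int (r choose j) * int ((q * (r - j)) choose i)) = 0"
        by simp
    qed
  qed auto
  finally show ?thesis .
qed

section \<open>Multisets of naturals as weakly increasing sequences\<close>

definition rank :: "nat multiset \<Rightarrow> nat \<Rightarrow> nat" where
  "rank g v = size (filter_mset (\<lambda>u. u \<le> v) g)"

lemma rank_0: "rank g 0 = count g 0"
  by (simp add: rank_def filter_eq_replicate_mset)

lemma rank_Suc: "rank g (Suc v) = rank g v + count g (Suc v)"
proof -
  have "filter_mset (\<lambda>u. u \<le> Suc v) g =
        filter_mset (\<lambda>u. u \<le> v) g + filter_mset (\<lambda>u. u = Suc v) g"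
    by (rule multiset_eqI) auto
  then show ?thesis
    by (simp add: rank_def filter_eq_replicate_mset)
qed

lemma rank_le_size: "rank g v \<le> size g"
  by (simp add: rank_def size_filter_mset_lesseq)

lemma rank_eq_size: "set_mset g \<subseteq> {..n} \<Longrightarrow> n \<le> v \<Longrightarrow> rank g v = size g"
  unfolding rank_def by (intro arg_cong[of _ _ size] filter_mset_eq_conv[THEN iffD2]) auto

lemma multiset_eq_if_ranks_eq:
  assumes "\<And>v. rank g v = rank h v"
  shows "g = h"
proof (rule multiset_eqI)
  fix v show "count g v = count h v"
    using assms[of v] assms[of "v - 1"] by (cases v) (simp_all add: rank_0 rank_Suc)
qed

text \<open>
  The multiset contains every place \<open>v\<close> as often as \<open>f\<close> jumps by a unit on entering \<open>v\<close>; a positive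
  value \<open>f 0\<close> counts as a jump at \<open>0\<close>.
\<close>

lemma exists_multiset_with_ranks:
  fixes f :: "nat \<Rightarrow> nat"
  assumes "mono f"
  shows "\<exists>g. set_mset g \<subseteq> {..n} \<and> (\<forall>v\<le>n. rank g v = f v)"
proof (induction n)
  case 0
  show ?case
    by (rule exI[of _ "replicate_mset (f 0) 0"]) (auto simp: rank_0)
next
  case (Suc n)
  then obtain g where g: "set_mset g \<subseteq> {..n}" "\<And>v. v \<le> n \<Longrightarrow> rank g v = f v"
    by auto
  let ?h = "g + replicate_mset (f (Suc n) - f n) (Suc n)"
  have below: "rank ?h v = f v" if "v \<le> n" for v
    using that g by (simp add: rank_def)
  have "count ?h (Suc n) = f (Suc n) - f n"
    using g(1) by (auto simp: not_in_iff[symmetric])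
  then have "rank ?h (Suc n) = f (Suc n)"
    using below[of n] monoD[OF assms, of n "Suc n"] by (simp add: rank_Suc)
  then have "\<forall>v\<le>Suc n. rank ?h v = f v"
    using below by (simp add: le_Suc_eq)
  moreover have "set_mset ?h \<subseteq> {..Suc n}"
    using g(1) by auto
  ultimately show ?case by blast
qed

section \<open>The expanding recurrence of a lifted orbit\<close>

text \<open>
  Only \<open>p\<close> modulo \<open>q\<close> matters for a rotational set.  The representative below \<open>q\<close> is chosen so that a
  step of \<open>m\<close> places crosses the origin of the circle at most once; this is what turns the
  normalization of \<open>X\<close> into exact bounds on the integers \<open>C\<close>.
\<close>

locale circle_rotation =
  fixes d p q k :: nat
  assumes d_gt_1: "d > 1" and k_pos: "k \<ge> 1" and p_less_q: "p < q" and coprime_p_q: "coprime p q"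
begin

abbreviation n :: nat where "n \<equiv> q * k"
abbreviation m :: nat where "m \<equiv> p * k"

lemma n_pos: "n > 0"
  using k_pos p_less_q by simp

lemma m_less_n: "m < n"
  using k_pos p_less_q by simp

lemma power_d_gt_1: "real d ^ q > 1"
  using d_gt_1 p_less_q by (intro one_less_power) auto

lemma shift_period:
  fixes X :: "nat \<Rightarrow> real"
  assumes "\<And>j. X (j + n) = X j + \<tau>"
  shows "X (j + s * n) = X j + real s * \<tau>"
proof (induction s)
  case (Suc s)
  have "X (j + Suc s * n) = X ((j + s * n) + n)"
    by (simp add: algebra_simps)
  also have "\<dots> = X j + real (Suc s) * \<tau>"
    by (simp only: assms Suc) (simp add: algebra_simps)
  finally show ?case .
qed simp

lemma shift_decompose:
  fixes X :: "nat \<Rightarrow> real"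
  assumes "\<And>j. X (j + n) = X j + \<tau>"
  shows "X j = X (j mod n) + real (j div n) * \<tau>"
  using shift_period[of X \<tau> "j mod n" "j div n", OF assms] unfolding mod_div_mult_eq .

text \<open>
  Both \<open>m\<close> and \<open>n\<close> are multiples of \<open>k\<close>.  After dividing by \<open>k\<close>, the claim is that multiples of \<open>p\<close> exhaust the
  residues modulo \<open>q\<close>; this is where coprimality enters.
\<close>

lemma residue_class_reached:
  assumes "i mod k = j mod k"
  shows "\<exists>t<q. (j + t * m) mod n = i mod n"
proof -
  have "j \<le> i + n * j"
    using n_pos by (intro trans_le_add2) simp
  \<comment> \<open>Adding \<open>n * j\<close> keeps the residue modulo \<open>n\<close> and makes the difference to \<open>j\<close> nonnegative.\<close>
  moreover have "(i + n * j) mod k = j mod k"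
    using assms by (simp add: mult.commute[of q] mult.assoc)
  ultimately obtain s where s: "i + n * j = j + k * s"
    by (metis le_Suc_ex mod_eq_dvd_iff_nat add_diff_cancel_left' dvdE)
  obtain u where u: "[p * u = 1] (mod q)"
    using cong_solve_coprime_nat[OF coprime_p_q] by auto
  define t where "t = (s * u) mod q"
  have "t < q"
    using p_less_q by (simp add: t_def)
  have "[t * p = s * u * p] (mod q)"
    unfolding t_def by (intro cong_mult cong_refl) (simp add: cong_def)
  also have "[s * u * p = s * 1] (mod q)"
    unfolding mult.assoc by (intro cong_mult cong_refl) (use u in \<open>simp add: mult.commute\<close>)
  finally have "(t * p) mod q = s mod q"
    by (simp add: cong_def)
  then have "(t * m) mod n = (k * s) mod n"
    using mod_mult_mult2[of "t * p" k q] mod_mult_mult2[of s k q] by (simp add: mult_ac)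
  then have "(j + t * m) mod n = (j + k * s) mod n"
    by (metis mod_add_right_eq)
  also have "\<dots> = i mod n"
    unfolding s[symmetric] by simp
  finally show ?thesis
    using \<open>t < q\<close> by blast
qed

definition orbit_sum :: "(nat \<Rightarrow> real) \<Rightarrow> nat \<Rightarrow> real" where
  "orbit_sum C j = (\<Sum>t<q. real d ^ (q - Suc t) * C (j + t * m))"

lemma orbit_sum_shift:
  "real d * orbit_sum C j - orbit_sum C (j + m) = real d ^ q * C j - C (j + q * m)"
proof -
  let ?f = "\<lambda>t. real d ^ (q - t) * C (j + t * m)"
  have "real d * orbit_sum C j = (\<Sum>t<q. ?f t)"
    unfolding orbit_sum_def sum_distrib_left
    by (intro sum.cong refl) (simp add: Suc_diff_Suc flip: power_Suc mult.assoc)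
  moreover have "orbit_sum C (j + m) = (\<Sum>t<q. ?f (Suc t))"
    by (simp add: orbit_sum_def add_ac)
  ultimately have "real d * orbit_sum C j - orbit_sum C (j + m) = (\<Sum>t<q. ?f t - ?f (Suc t))"
    by (simp add: sum_subtractf)
  also have "\<dots> = ?f 0 - ?f q"
    by (rule sum_lessThan_telescope')
  finally show ?thesis by simp
qed

text \<open>
  Iterating the recurrence \<open>q\<close> times leads from \<open>X j\<close> to \<open>X (j + q * m) = X (j + p * n)\<close>, which is
  \<open>X j\<close> again up to \<open>p\<close> periods.  The increment \<open>\<tau>\<close> per period is \<open>1\<close> for the points themselves and \<open>0\<close> for
  the gaps between them.
\<close>

lemma orbit_sum_of_solution:
  assumes rec: "\<And>j. real d * X j = X (j + m) + C j"
    and per: "\<And>j. X (j + n) = X j + \<tau>"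
  shows "(real d ^ q - 1) * X j = orbit_sum C j + real p * \<tau>"
proof -
  let ?f = "\<lambda>t. real d ^ (q - t) * X (j + t * m)"
  have "orbit_sum C j = (\<Sum>t<q. ?f t - ?f (Suc t))"
    unfolding orbit_sum_def
  proof (intro sum.cong refl)
    fix t assume "t \<in> {..<q}"
    then have exponent: "q - t = Suc (q - Suc t)"
      by auto
    have C_eq: "C (j + t * m) = real d * X (j + t * m) - X (j + Suc t * m)"
      using rec[of "j + t * m"] by (simp add: add_ac)
    show "real d ^ (q - Suc t) * C (j + t * m) = ?f t - ?f (Suc t)"
      unfolding exponent C_eq by (simp add: algebra_simps)
  qed
  also have "\<dots> = ?f 0 - ?f q"
    by (rule sum_lessThan_telescope')
  also have "\<dots> = real d ^ q * X j - X (j + p * n)"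
    by (simp add: mult_ac)
  also have "X (j + p * n) = X j + real p * \<tau>"
    by (rule shift_period[of X, OF per])
  finally show ?thesis
    by (simp add: algebra_simps)
qed

definition solution :: "(nat \<Rightarrow> real) \<Rightarrow> nat \<Rightarrow> real" where
  "solution C j = (orbit_sum C j + real p) / (real d ^ q - 1)"

lemma solution_unique:
  assumes "\<And>j. real d * X j = X (j + m) + C j" "\<And>j. X (j + n) = X j + 1"
  shows "X = solution C"
proof
  fix j show "X j = solution C j"
    using orbit_sum_of_solution[OF assms, of j] power_d_gt_1
    by (simp add: solution_def field_simps)
qed

lemma solution_works:
  assumes per: "\<And>j. C (j + n) = C j + (real d - 1)"
  shows "real d * solution C j = solution C (j + m) + C j"
    and "solution C (j + n) = solution C j + 1"
proof -
  let ?D = "real d ^ q - 1"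
  have "?D > 0"
    using power_d_gt_1 by simp
  have "C (j + q * m) = C j + real p * (real d - 1)"
    using shift_period[of C "real d - 1", OF per, of j p] by (simp add: mult_ac)
  then have "real d * (orbit_sum C j + real p) - (orbit_sum C (j + m) + real p) = ?D * C j"
    using orbit_sum_shift[of C j] by (simp add: algebra_simps)
  then show "real d * solution C j = solution C (j + m) + C j"
    using \<open>?D > 0\<close> by (simp add: solution_def field_simps)
  have "orbit_sum C (j + n) - orbit_sum C j =
        (\<Sum>t<q. real d ^ (q - Suc t) * (C (j + t * m + n) - C (j + t * m)))"
    by (simp add: orbit_sum_def sum_subtractf algebra_simps)
  also have "\<dots> = (\<Sum>t<q. real d ^ (q - Suc t) * (real d - 1))"
    by (simp only: per add_diff_cancel_left')
  also have "\<dots> = (real d - 1) * (\<Sum>t<q. real d ^ (q - Suc t))"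
    by (simp add: sum_distrib_left mult.commute)
  also have "\<dots> = ?D"
    using sum.nat_diff_reindex[of "\<lambda>i. real d ^ i" q] d_gt_1 geometric_sum[of "real d" q] by simp
  finally show "solution C (j + n) = solution C j + 1"
    using \<open>?D > 0\<close> by (simp add: solution_def field_simps)
qed

text \<open>
  By the closed formula, \<open>Y j\<close> is a positive combination of the values of \<open>E\<close> along the orbit of \<open>j\<close>,
  which runs through the whole residue class modulo \<open>k\<close>.
\<close>

lemma gap_pos_iff:
  assumes rec: "\<And>j. real d * Y j = Y (j + m) + E j"
    and per: "\<And>j. Y (j + n) = Y j"
    and nonneg: "\<And>j. E j \<ge> 0"
  shows "Y j > 0 \<longleftrightarrow> (\<exists>i. i mod k = j mod k \<and> E i > 0)"
proof -
  have E_eq: "E i = real d * Y i - Y (i + m)" for i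
    using rec[of i] by simp
  have E_per: "E i = E i'" if "i mod n = i' mod n" for i i'
  proof -
    have "E (i + n) = E i" for i
      unfolding E_eq using per[of i] per[of "i + m"] by (simp add: add_ac)
    then have "E i = E (i mod n)" for i
      using shift_decompose[of E 0 i] by simp
    then show ?thesis
      using that by metis
  qed
  have eq: "(real d ^ q - 1) * Y j = orbit_sum E j"
    using orbit_sum_of_solution[of Y E 0] rec per by simp
  have "Y j > 0 \<longleftrightarrow> orbit_sum E j > 0"
    using power_d_gt_1 unfolding eq[symmetric] by (simp add: zero_less_mult_iff)
  also have "\<dots> \<longleftrightarrow> (\<exists>t<q. E (j + t * m) > 0)"
  proof
    assume "orbit_sum E j > 0"
    show "\<exists>t<q. E (j + t * m) > 0"
    proof (rule ccontr)
      assume "\<not> ?thesis"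
      then have "E (j + t * m) \<le> 0" if "t < q" for t
        using that by (meson not_less)
      then have "orbit_sum E j \<le> 0"
        unfolding orbit_sum_def by (intro sum_nonpos mult_nonneg_nonpos) simp_all
      then show False
        using \<open>orbit_sum E j > 0\<close> by simp
    qed
  next
    assume "\<exists>t<q. E (j + t * m) > 0"
    then obtain t where "t < q" "E (j + t * m) > 0"
      by auto
    then show "orbit_sum E j > 0"
      unfolding orbit_sum_def using d_gt_1 nonneg
      by (intro sum_pos2[of _ t]) auto
  qed
  also have "\<dots> \<longleftrightarrow> (\<exists>i. i mod k = j mod k \<and> E i > 0)"
  proof
    assume "\<exists>t<q. E (j + t * m) > 0"
    then obtain t where "E (j + t * m) > 0"
      by auto
    moreover have "(j + t * m) mod k = j mod k"
      by (simp add: mult.assoc[symmetric])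
    ultimately show "\<exists>i. i mod k = j mod k \<and> E i > 0"
      by blast
  next
    assume "\<exists>i. i mod k = j mod k \<and> E i > 0"
    then show "\<exists>t<q. E (j + t * m) > 0"
      using residue_class_reached[of _ j] E_per by metis
  qed
  finally show ?thesis .
qed

section \<open>Rotational sets as increasing sequences on the line\<close>

text \<open>
  The enumeration of a rotational set, unrolled from the circle to the line.  The bounds on \<open>X 0\<close> and
  \<open>X (n - 1)\<close> normalize the sequence, so that it starts at the first point of the set.
\<close>

definition rotational_lift :: "(nat \<Rightarrow> real) \<Rightarrow> bool" where
  "rotational_lift X \<longleftrightarrow> strict_mono X \<and> (\<forall>j. X (j + n) = X j + 1) \<and> 0 \<le> X 0 \<and> X (n - 1) < 1 \<and>
     (\<forall>j. real d * X j - X (j + m) \<in> \<int>)"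

lemma rotational_liftD:
  assumes "rotational_lift X"
  shows "strict_mono X" "X (j + n) = X j + 1" "0 \<le> X 0" "X (n - 1) < 1"
    "real d * X j - X (j + m) \<in> \<int>"
    "X j = X (j mod n) + real (j div n)"
    "i < n \<Longrightarrow> 0 \<le> X i" "i < n \<Longrightarrow> X i < 1"
proof -
  show "strict_mono X" "X (j + n) = X j + 1" "0 \<le> X 0" "X (n - 1) < 1"
    "real d * X j - X (j + m) \<in> \<int>"
    using assms by (auto simp: rotational_lift_def)
  show "X j = X (j mod n) + real (j div n)"
    using shift_decompose[of X 1 j] assms by (simp add: rotational_lift_def)
  have "mono X"
    using \<open>strict_mono X\<close> by (rule strict_mono_mono)
  show "0 \<le> X i" if "i < n"
    using \<open>0 \<le> X 0\<close> monoD[OF \<open>mono X\<close>, of 0 i] by simp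
  show "X i < 1" if "i < n"
  proof -
    have "i \<le> n - 1"
      using that by linarith
    then show ?thesis
      using \<open>X (n - 1) < 1\<close> monoD[OF \<open>mono X\<close> \<open>i \<le> n - 1\<close>] by linarith
  qed
qed

lemma sorted_list_of_rotational_lift:
  assumes "rotational_lift X"
  shows "sorted_list_of_set (X ` {..<n}) = map X [0..<n]"
proof -
  have "sorted_wrt (<) (map X [0..<n])"
    using strict_monoD[OF rotational_liftD(1)[OF assms]]
    by (auto simp: sorted_wrt_iff_nth_less)
  moreover have "set (map X [0..<n]) = X ` {..<n}"
    by (auto simp: atLeast0LessThan)
  ultimately show ?thesis
    by (metis sorted_list_of_set.idem_if_sorted_distinct strict_sorted_iff)
qed

lemma rotational_lift_inject:
  assumes "rotational_lift X" "rotational_lift X'" "X ` {..<n} = X' ` {..<n}"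
  shows "X = X'"
proof
  fix j
  have "map X [0..<n] = map X' [0..<n]"
    using sorted_list_of_rotational_lift assms by metis
  then have "X i = X' i" if "i < n" for i
    using that by simp
  then show "X j = X' j"
    using rotational_liftD(6)[OF assms(1), of j] rotational_liftD(6)[OF assms(2), of j] n_pos by simp
qed

lemma rotational_set_imp_lift:
  assumes "rotational_set d p q k P"
  shows "\<exists>X. rotational_lift X \<and> P = X ` {..<n}"
proof -
  define xs where "xs = sorted_list_of_set P"
  define X where "X j = xs ! (j mod n) + real (j div n)" for j
  have P: "finite P" "P \<subseteq> {0..<1}" "card P = n"
    and step: "\<And>i. i < n \<Longrightarrow> sigma d (xs ! i) = xs ! ((i + m) mod n)"
    using assms by (auto simp: rotational_set_def Let_def xs_def)
  have xs: "set xs = P" "length xs = n" "sorted_wrt (<) xs"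
    using P by (auto simp: xs_def)
  have in_P: "xs ! i \<in> P" if "i < n" for i
    using that xs by (metis nth_mem)
  have range: "0 \<le> xs ! i" "xs ! i < 1" if "i < n" for i
    using in_P[OF that] P(2) by auto
  have X_below: "X i = xs ! i" if "i < n" for i
    using that by (simp add: X_def)
  have "strict_mono X"
  proof (rule strict_mono_Suc_iff[THEN iffD2], rule allI)
    fix j
    have "j mod n < n"
      using n_pos by simp
    show "X j < X (Suc j)"
    proof (cases "Suc (j mod n) < n")
      case True
      then have "Suc j mod n = Suc (j mod n)" "Suc j div n = j div n"
        by (simp_all add: mod_Suc div_Suc)
      then show ?thesis
        using True xs by (simp add: X_def sorted_wrt_nth_less)
    next
      case False
      then have "Suc (j mod n) = n"
        using \<open>j mod n < n\<close> by simp
      then have "Suc j mod n = 0" "Suc j div n = Suc (j div n)"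
        by (simp_all add: mod_Suc div_Suc)
      then show ?thesis
        using range(2)[of "j mod n"] range(1)[of 0] n_pos by (simp add: X_def)
    qed
  qed
  moreover have "X (j + n) = X j + 1" for j
    using n_pos by (simp add: X_def)
  moreover have "0 \<le> X 0" "X (n - 1) < 1"
    using range n_pos by (simp_all add: X_below)
  moreover have "real d * X j - X (j + m) \<in> \<int>" for j
  proof -
    let ?i = "j mod n"
    have "real d * xs ! ?i - xs ! ((j + m) mod n) = of_int \<lfloor>real d * xs ! ?i\<rfloor>"
      using step[of ?i] n_pos by (simp add: sigma_def frac_def mod_add_left_eq)
    then have "real d * X j - X (j + m) =
      of_int (\<lfloor>real d * xs ! ?i\<rfloor> + int (d * (j div n)) - int ((j + m) div n))"
      by (simp add: X_def algebra_simps)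
    then show ?thesis
      by (metis Ints_of_int)
  qed
  moreover have "P = X ` {..<n}"
  proof -
    have "P = (!) xs ` {..<n}"
      using xs(1,2) by (auto simp: set_conv_nth)
    then show ?thesis
      using X_below by simp
  qed
  ultimately show ?thesis
    unfolding rotational_lift_def by blast
qed

text \<open>
  On the circle the recurrence reads \<open>sigma d (x i) = x (i + m)\<close>.  Invariance holds because shifting by
  \<open>m\<close> permutes the indices modulo \<open>n\<close>; any \<open>k\<close> consecutive points lie in different orbits because the
  orbit of \<open>x i\<close> only visits indices congruent to \<open>i\<close> modulo \<open>k\<close>.
\<close>

lemma lift_imp_rotational_set:
  assumes "rotational_lift X"
  shows "rotational_set d p q k (X ` {..<n})"
proof -
  define x where "x i = X (i mod n)" for i
  note X = rotational_liftD[OF assms]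
  have mod_less: "i mod n < n" for i
    using n_pos by simp
  have x_inj: "i mod n = j mod n" if "x i = x j" for i j
    using that strict_mono_eq[OF X(1)] by (simp add: x_def)
  have x_mod: "x i = x j" if "i mod n = j mod n" for i j
    using that by (simp add: x_def)
  have sigma_x: "sigma d (x i) = x (i + m)" for i
  proof -
    have "real d * x i - x (i + m) =
          (real d * X (i mod n) - X (i mod n + m)) + real ((i mod n + m) div n)"
      using X(6)[of "i mod n + m"] by (simp add: x_def mod_add_left_eq)
    also have "\<dots> \<in> \<int>"
      using X(5)[of "i mod n"] by simp
    finally show ?thesis
      unfolding sigma_def frac_unique_iff
      using X(7)[OF mod_less] X(8)[OF mod_less] by (simp add: x_def)
  qed
  have iterate_x: "(sigma d ^^ t) (x i) = x (i + t * m)" for t i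
    by (induction t) (simp_all add: sigma_x add_ac)
  have P_eq: "X ` {..<n} = range x"
  proof
    show "X ` {..<n} \<subseteq> range x"
    proof
      fix y assume "y \<in> X ` {..<n}"
      then obtain i where "i < n" "y = X i" by auto
      then have "y = x i" by (simp add: x_def)
      then show "y \<in> range x" by simp
    qed
    show "range x \<subseteq> X ` {..<n}"
      using mod_less by (auto simp: x_def)
  qed
  have "sigma d ` range x = range x"
  proof
    show "sigma d ` range x \<subseteq> range x"
      by (auto simp: sigma_x)
    show "range x \<subseteq> sigma d ` range x"
    proof clarify
      fix i
      \<comment> \<open>Taking \<open>q - 1\<close> steps of size \<open>m\<close> undoes one step, since \<open>q * m = p * n\<close>.\<close>
      have period: "i + (q - 1) * m + m = i + p * n"
        using p_less_q by (cases q) (simp_all add: algebra_simps)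
      have "sigma d (x (i + (q - 1) * m)) = x i"
        unfolding sigma_x period by (rule x_mod) simp
      then show "x i \<in> sigma d ` range x"
        by (metis rangeI image_eqI)
    qed
  qed
  moreover have "a = b" if "orbit d (x (i + a)) = orbit d (x (i + b))" "a < k" "b < k" for i a b
  proof -
    have "x (i + a) = (sigma d ^^ 0) (x (i + a))"
      by simp
    then have "x (i + a) \<in> orbit d (x (i + b))"
      unfolding orbit_def that(1)[unfolded orbit_def, symmetric] by blast
    then obtain t where "x (i + a) = x (i + b + t * m)"
      unfolding orbit_def iterate_x by blast
    then have "(i + a) mod n = (i + b + t * m) mod n"
      by (rule x_inj)
    then have "(i + a) mod n mod k = (i + b + t * m) mod n mod k"
      by (rule arg_cong)
    then have "(i + a) mod k = (i + b + t * m) mod k"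
      by (simp add: mod_mod_cancel)
    then have "(i + a) mod k = (i + b) mod k"
      by (simp add: mult.assoc[symmetric])
    then have "[i + a = i + b] (mod k)"
      by (simp only: cong_def)
    then have "[a = b] (mod k)"
      by (simp only: cong_add_lcancel_nat)
    then show "a = b"
      using that(2,3) by (simp add: cong_def)
  qed
  moreover have enum: "(\<lambda>i. sorted_list_of_set (X ` {..<n}) ! (i mod n)) = x"
    using mod_less by (intro ext) (simp add: sorted_list_of_rotational_lift[OF assms] x_def)
  moreover have "card (X ` {..<n}) = n"
    using strict_mono_imp_inj_on[OF X(1), of "{..<n}"] by (simp add: card_image)
  moreover have "X ` {..<n} \<subseteq> {0..<1}"
    using X(7,8) by auto
  ultimately show ?thesis
    unfolding rotational_set_def Let_def enum P_eq[symmetric]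
    using sigma_x by auto
qed

section \<open>Coding rotational sets by multisets\<close>

text \<open>
  An element \<open>v\<close> of the multiset stands for a unit jump of \<open>C\<close> from \<open>v - 1\<close> to \<open>v\<close>.  An ascent of \<open>C\<close> at an
  index \<open>i\<close> is therefore an occurrence of \<open>Suc i\<close>.  The elements \<open>0\<close> make up \<open>C 0\<close>, and the elements \<open>n\<close>
  account for the difference between \<open>C (n - 1)\<close> and its bound \<open>d - 2\<close>.
\<close>

definition admissible :: "nat multiset \<Rightarrow> bool" where
  "admissible g \<longleftrightarrow> g \<in> multisets_of_size {..n} (d - 2) \<and>
     (\<forall>a<k - 1. \<exists>v\<in>Suc ` {i. i < n \<and> i mod k = a}. v \<in># g)"

text \<open>
  The integers \<open>C j = d * X j - X (j + m)\<close>, that is, the full turns lost when \<open>d * X j\<close> is brought back to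
  \<open>X (j + m)\<close>.  Moving once around the circle raises \<open>d * X\<close> by \<open>d\<close> and \<open>X\<close> by \<open>1\<close>, hence the slope \<open>d - 1\<close>.
\<close>

definition carries :: "nat multiset \<Rightarrow> nat \<Rightarrow> real" where
  "carries g j = real (rank g (j mod n)) + (real d - 1) * real (j div n)"

lemma carries_shift: "carries g (j + n) = carries g j + (real d - 1)"
  using n_pos by (simp add: carries_def algebra_simps)

lemma carries_below: "j < n \<Longrightarrow> carries g j = real (rank g j)"
  by (simp add: carries_def)

lemma carries_inject:
  assumes "admissible g" "admissible h" "carries g = carries h"
  shows "g = h"
proof (rule multiset_eq_if_ranks_eq)
  fix v show "rank g v = rank h v"
  proof (cases "v < n")
    case True
    then show ?thesis
      using carries_below[of v] assms(3) by (metis of_nat_eq_iff)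
  next
    case False
    then show ?thesis
      using assms(1,2) by (simp add: admissible_def multisets_of_size_def rank_eq_size[of _ n])
  qed
qed

text \<open>
  The last index \<open>n - 1\<close> is congruent to \<open>k - 1\<close> modulo \<open>k\<close>, so ascents in the other residue classes never
  wrap around the origin.
\<close>

lemma last_residue: "i < n \<Longrightarrow> i mod k < k - 1 \<Longrightarrow> Suc i < n"
proof (rule ccontr)
  assume i: "i < n" "i mod k < k - 1" "\<not> Suc i < n"
  then have "Suc i = n" by simp
  then have "Suc i mod k = 0" by simp
  then show False
    using i(2) by (simp add: mod_Suc split: if_splits)
qed

text \<open>
  Admissibility provides a positive increment of the carries in every residue class other than that of
  \<open>k - 1\<close>; in that class the increment at \<open>n - 1\<close>, which wraps around the origin, is at least
  \<open>(d - 1) - (d - 2)\<close>.  So all gaps are positive.  Monotonicity then gives the normalization: comparing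
  \<open>X m\<close> with \<open>X 0\<close> in the recurrence at \<open>0\<close> bounds \<open>X 0\<close>, and comparing \<open>X (n - 1 + m)\<close> with
  \<open>X (n - 1 + n)\<close> in the recurrence at \<open>n - 1\<close> bounds \<open>X (n - 1)\<close>.
\<close>

lemma rotational_lift_solution:
  assumes "admissible g"
  shows "rotational_lift (solution (carries g))"
proof -
  define X where "X = solution (carries g)"
  define E where "E j = carries g (Suc j) - carries g j" for j
  have rec: "real d * X j = X (j + m) + carries g j" and per: "X (j + n) = X j + 1" for j
    unfolding X_def by (rule solution_works[of "carries g", OF carries_shift])+
  have size: "size g = d - 2" and hits: "\<And>a. a < k - 1 \<Longrightarrow> \<exists>i<n. i mod k = a \<and> Suc i \<in># g"
    using assms by (auto simp: admissible_def multisets_of_size_def)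
  have E_per: "E j = E (j mod n)" for j
  proof -
    have "E (j + n) = E j + 0" for j
      using carries_shift[of g j] carries_shift[of g "Suc j"] by (simp add: E_def)
    then show ?thesis
      using shift_decompose[of E 0 j] by simp
  qed
  have E_inner: "E i = real (count g (Suc i))" if "Suc i < n" for i
    using that by (simp add: E_def carries_below rank_Suc)
  have E_last: "E (n - 1) \<ge> 1"
  proof -
    have "carries g n = real (rank g 0) + (real d - 1)"
      using carries_shift[of g 0] carries_below[of 0 g] n_pos by simp
    moreover have "carries g (n - 1) \<le> real d - 2"
      using rank_le_size[of g "n - 1"] size d_gt_1 n_pos by (simp add: carries_below)
    ultimately show ?thesis
      using n_pos by (simp add: E_def)
  qed
  have E_nonneg: "E j \<ge> 0" for j
  proof (cases "Suc (j mod n) < n")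
    case True
    then show ?thesis by (subst E_per) (simp add: E_inner)
  next
    case False
    then have "j mod n = n - 1"
      using mod_less_divisor[OF n_pos, of j] by linarith
    then show ?thesis
      using E_last by (subst E_per) simp
  qed
  have E_pos: "\<exists>i. i mod k = j mod k \<and> E i > 0" for j
  proof (cases "j mod k < k - 1")
    case True
    then obtain i where "i < n" "i mod k = j mod k" "Suc i \<in># g"
      using hits by blast
    then show ?thesis
      using True last_residue[of i] by (intro exI[of _ i]) (simp add: E_inner)
  next
    case False
    then have "j mod k = k - 1"
      using mod_less_divisor[of k j] k_pos by linarith
    moreover have "(n - 1) mod k = k - 1"
    proof -
      have "n - 1 = (k - 1) + (q - 1) * k"
        using k_pos p_less_q by (cases q) (simp_all add: algebra_simps)
      then have "(n - 1) mod k = (k - 1) mod k"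
        by (simp only: mod_mult_self1)
      then show ?thesis
        using k_pos by simp
    qed
    ultimately show ?thesis
      using E_last by (intro exI[of _ "n - 1"]) simp
  qed
  have "X (Suc j) - X j > 0" for j
  proof -
    have "(X (Suc j) - X j > 0) = (\<exists>i. i mod k = j mod k \<and> E i > 0)"
    proof (rule gap_pos_iff[where Y = "\<lambda>j. X (Suc j) - X j"])
      show "real d * (X (Suc j) - X j) = X (Suc (j + m)) - X (j + m) + E j" for j
        using rec[of j] rec[of "Suc j"] by (simp add: E_def algebra_simps)
      show "X (Suc (j + n)) - X (j + n) = X (Suc j) - X j" for j
        using per[of j] per[of "Suc j"] by simp
    qed (rule E_nonneg)
    then show ?thesis
      using E_pos by blast
  qed
  then have strict: "strict_mono X"
    by (simp add: strict_mono_Suc_iff)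
  have "0 \<le> (real d - 1) * X 0"
  proof -
    have "X 0 \<le> X m"
      using strict_mono_less_eq[OF strict] by simp
    then show ?thesis
      using rec[of 0] carries_below[of 0 g] n_pos by (simp add: algebra_simps)
  qed
  then have "0 \<le> X 0"
    using d_gt_1 by (simp add: zero_le_mult_iff)
  have "(real d - 1) * X (n - 1) < (real d - 1) * 1"
  proof -
    have "X (n - 1 + m) < X (n - 1 + n)"
      by (intro strict_monoD[OF strict] add_strict_left_mono m_less_n)
    moreover have "carries g (n - 1) \<le> real d - 2"
      using rank_le_size[of g "n - 1"] size d_gt_1 n_pos by (simp add: carries_below)
    ultimately show ?thesis
      using rec[of "n - 1"] per[of "n - 1"] by (simp add: algebra_simps)
  qed
  then have "X (n - 1) < 1"
    using d_gt_1 by simp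
  moreover have "real d * X j - X (j + m) \<in> \<int>" for j
    by (simp add: rec carries_def)
  ultimately show ?thesis
    using strict per \<open>0 \<le> X 0\<close> by (simp add: rotational_lift_def X_def)
qed

text \<open>
  The converse estimates: gaps lie in \<open>{0<..1}\<close>, so the integer increments exceed \<open>-1\<close>, and the
  normalization of \<open>X\<close> confines the carries of the first \<open>n\<close> indices to \<open>{0..d - 2}\<close>.  Every residue class
  contains an ascent because all gaps are positive.
\<close>

lemma rotational_lift_is_solution:
  assumes "rotational_lift X"
  shows "\<exists>g. admissible g \<and> X = solution (carries g)"
proof -
  note X = rotational_liftD[OF assms]
  define C where "C j = \<lfloor>real d * X j - X (j + m)\<rfloor>" for j
  define E where "E j = C (Suc j) - C j" for j
  have rec: "real d * X j = X (j + m) + of_int (C j)" for j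
    using X(5)[of j] by (simp add: C_def)
  have gap: "0 < X (Suc j) - X j" "X (Suc j) - X j \<le> 1" for j
  proof -
    show "0 < X (Suc j) - X j"
      using strict_monoD[OF X(1), of j "Suc j"] by simp
    have "X (Suc j) \<le> X (j + n)"
      using n_pos by (simp add: strict_mono_less_eq[OF X(1)])
    then show "X (Suc j) - X j \<le> 1"
      using X(2)[of j] by simp
  qed
  have gap_rec: "real d * (X (Suc j) - X j) = X (Suc (j + m)) - X (j + m) + of_int (E j)" for j
    using rec[of j] rec[of "Suc j"] by (simp add: E_def algebra_simps)
  have E_nonneg: "E j \<ge> 0" for j
  proof -
    have "0 < real d * (X (Suc j) - X j)"
      using gap(1)[of j] d_gt_1 by simp
    then have "-1 < real_of_int (E j)"
      using gap_rec[of j] gap(2)[of "j + m"] by linarith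
    then show ?thesis by linarith
  qed
  have "mono C"
    using E_nonneg by (simp add: mono_iff_le_Suc E_def)
  have "-1 < real_of_int (C 0)"
    using rec[of 0] X(3) X(8)[OF m_less_n] d_gt_1 by (smt (verit) add_0 mult_nonneg_nonneg of_nat_0_le_iff)
  then have "0 \<le> C 0"
    by linarith
  then have C_nonneg: "0 \<le> C j" for j
    using monoD[OF \<open>mono C\<close>, of 0 j] by simp
  have "real_of_int (C (n - 1)) < real d - 1"
  proof -
    have "X (n - 1) \<le> X (n - 1 + m)"
      by (simp add: strict_mono_less_eq[OF X(1)])
    then have "real_of_int (C (n - 1)) \<le> (real d - 1) * X (n - 1)"
      using rec[of "n - 1"] by (simp add: algebra_simps)
    also have "\<dots> < (real d - 1) * 1"
      using X(4) d_gt_1 by (intro mult_strict_left_mono) auto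
    finally show ?thesis by simp
  qed
  then have C_le: "nat (C j) \<le> d - 2" if "j < n" for j
    using monoD[OF \<open>mono C\<close>, of j "n - 1"] that d_gt_1 by linarith
  \<comment> \<open>From \<open>n\<close> on, the ranks equal the total number \<open>d - 2\<close> of jumps.\<close>
  define f where "f v = (if v < n then nat (C v) else d - 2)" for v
  have "mono f"
    using monoD[OF \<open>mono C\<close>] C_le by (auto simp: mono_def f_def intro: nat_mono)
  then obtain g where g: "set_mset g \<subseteq> {..n}" "\<And>v. v \<le> n \<Longrightarrow> rank g v = f v"
    using exists_multiset_with_ranks[of f n] by blast
  have carries: "carries g j = of_int (C j)" for j
  proof -
    have "real_of_int (C (j + n)) = real_of_int (C j) + (real d - 1)" for j
      using rec[of j] rec[of "j + n"] X(2)[of j] X(2)[of "j + m"] by (simp add: algebra_simps)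
    then have "real_of_int (C j) = real_of_int (C (j mod n)) + real (j div n) * (real d - 1)"
      by (rule shift_decompose[of "\<lambda>j. real_of_int (C j)"])
    then show ?thesis
      using n_pos g(2)[of "j mod n"] C_nonneg[of "j mod n"] by (simp add: carries_def f_def)
  qed
  have "size g = d - 2"
    using rank_eq_size[OF g(1), of n] g(2)[of n] by (simp add: f_def)
  moreover have "\<exists>i<n. i mod k = a \<and> Suc i \<in># g" if "a < k - 1" for a
  proof -
    have "a mod k = a"
      using that by simp
    have "(X (Suc a) - X a > 0) = (\<exists>i. i mod k = a mod k \<and> real_of_int (E i) > 0)"
      by (rule gap_pos_iff[where Y = "\<lambda>j. X (Suc j) - X j"])
        (use gap_rec X(2)[of "Suc _"] X(2) E_nonneg in \<open>auto\<close>)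
    then obtain i where i: "i mod k = a" "E i > 0"
      using gap(1)[of a] \<open>a mod k = a\<close> by auto
    define i' where "i' = i mod n"
    have "i' < n"
      using n_pos by (simp add: i'_def)
    moreover have "i' mod k = a"
      using i(1) by (simp add: i'_def mod_mod_cancel)
    ultimately have "Suc i' < n"
      using last_residue that by blast
    have i_eq: "i' + i div n * n = i"
      unfolding i'_def by (rule mod_div_mult_eq)
    have "carries g (i' + i div n * n + s) =
          carries g (i' + s) + real (i div n) * (real d - 1)" for s
      using shift_period[of "carries g" "real d - 1" "i' + s" "i div n", OF carries_shift]
      by (simp only: add_ac)
    then have "carries g (i + s) = carries g (i' + s) + real (i div n) * (real d - 1)" for s
      unfolding i_eq .
    from this[of 0] this[of 1] have "E i' = E i"
      using carries by (simp add: E_def)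
    then have "rank g i' < rank g (Suc i')"
      using i(2) \<open>Suc i' < n\<close> g(2)[of i'] g(2)[of "Suc i'"] C_nonneg[of i'] C_nonneg[of "Suc i'"]
      by (simp add: f_def E_def)
    then have "Suc i' \<in># g"
      by (simp add: rank_Suc)
    then show ?thesis
      using \<open>i' < n\<close> \<open>i' mod k = a\<close> by blast
  qed
  ultimately have "admissible g"
    using g(1) unfolding admissible_def multisets_of_size_def by fast
  moreover have "X = solution (carries g)"
    by (rule solution_unique) (simp_all add: rec carries X(2))
  ultimately show ?thesis by blast
qed

lemma bij_betw_admissible_rotational_sets:
  "bij_betw (\<lambda>g. solution (carries g) ` {..<n}) {g. admissible g} {P. rotational_set d p q k P}"
proof (rule bij_betw_imageI)
  show "inj_on (\<lambda>g. solution (carries g) ` {..<n}) {g. admissible g}"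
  proof (rule inj_onI, clarify)
    fix g h assume adm: "admissible g" "admissible h"
      and "solution (carries g) ` {..<n} = solution (carries h) ` {..<n}"
    then have eq: "solution (carries g) = solution (carries h)"
      using rotational_lift_inject rotational_lift_solution by blast
    have "carries g j = real d * solution (carries g) j - solution (carries g) (j + m)" for g j
      using solution_works(1)[of "carries g" j] carries_shift by simp
    from this[of g] this[of h] have "carries g = carries h"
      unfolding eq by (intro ext) simp
    then show "g = h"
      using carries_inject adm by blast
  qed
  show "(\<lambda>g. solution (carries g) ` {..<n}) ` {g. admissible g} = {P. rotational_set d p q k P}"
  proof (intro equalityI subsetI)
    fix P assume "P \<in> {P. rotational_set d p q k P}"
    then obtain X where "rotational_lift X" "P = X ` {..<n}"
      using rotational_set_imp_lift by blast
    then show "P \<in> (\<lambda>g. solution (carries g) ` {..<n}) ` {g. admissible g}"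
      using rotational_lift_is_solution by blast
  qed (use lift_imp_rotational_set rotational_lift_solution in auto)
qed

section \<open>The number of rotational sets\<close>

lemma card_admissible:
  "int (card {g. admissible g}) =
   (\<Sum>j\<le>k - 1. (- 1) ^ j * int ((k - 1) choose j) *
      int ((d + q - 2 + q * (k - 1 - j)) choose (d - 2)))"
proof -
  let ?B = "\<lambda>a. Suc ` {i. i < n \<and> i mod k = a}"
  have "card (?B a) = q" if "a < k - 1" for a
  proof -
    have "{i. i < n \<and> i mod k = a} = (\<lambda>s. a + s * k) ` {..<q}"
    proof (intro equalityI subsetI)
      fix i assume "i \<in> {i. i < n \<and> i mod k = a}"
      then have "i = a + (i div k) * k" "i div k < q"
        by (auto simp: less_mult_imp_div_less)
      then show "i \<in> (\<lambda>s. a + s * k) ` {..<q}" by blast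
    next
      fix i assume "i \<in> (\<lambda>s. a + s * k) ` {..<q}"
      then obtain s where s: "s < q" "i = a + s * k" by blast
      have "i < Suc s * k"
        using s that by simp
      also have "\<dots> \<le> q * k"
        using s(1) by (intro mult_le_mono1) simp
      finally show "i \<in> {i. i < n \<and> i mod k = a}"
        using s(2) that by simp
    qed
    moreover have "inj_on (\<lambda>s. a + s * k) {..<q}"
      using k_pos by (auto simp: inj_on_def)
    ultimately show ?thesis
      by (simp add: card_image)
  qed
  then have "int (card {g \<in> multisets_of_size {..n} (d - 2).
                   \<forall>a\<in>{..<k - 1}. \<exists>v\<in>?B a. v \<in># g}) =
    (\<Sum>j\<le>card {..<k - 1}. (- 1) ^ j * int (card {..<k - 1} choose j) *
       int ((card {..n} - q * j + (d - 2) - 1) choose (d - 2)))"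
    by (intro card_multisets_hitting_blocks) (auto simp: disjoint_family_on_def)
  also have "\<dots> = (\<Sum>j\<le>k - 1. (- 1) ^ j * int ((k - 1) choose j) *
      int ((d + q - 2 + q * (k - 1 - j)) choose (d - 2)))"
  proof (simp only: card_lessThan, intro sum.cong refl)
    fix j assume "j \<in> {..k - 1}"
    then have "q * (j + (k - 1 - j) + 1) = q * k"
      using k_pos by simp
    then have "q * j + q * (k - 1 - j) + q = q * k"
      by (simp only: distrib_left mult_1_right)
    then have "card {..n} - q * j + (d - 2) - 1 = d + q - 2 + q * (k - 1 - j)"
      using d_gt_1 by simp
    then show "(- 1) ^ j * int ((k - 1) choose j) *
        int ((card {..n} - q * j + (d - 2) - 1) choose (d - 2)) =
      (- 1) ^ j * int ((k - 1) choose j) * int ((d + q - 2 + q * (k - 1 - j)) choose (d - 2))"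
      by simp
  qed
  finally show ?thesis
    by (simp add: admissible_def Ball_def)
qed

end

lemma rotational_set_mod: "rotational_set d (p mod q) q k P = rotational_set d p q k P"
proof -
  have "(i + (p mod q) * k) mod (q * k) = (i + p * k) mod (q * k)" for i
    by (metis mod_add_right_eq mod_mult_mult2 mod_mod_trivial)
  then show ?thesis
    by (simp add: rotational_set_def Let_def)
qed

theorem theorem21:
  fixes d p q k l :: nat and B :: "real set set"
  assumes "d > 1" and "p \<ge> 1" and "q \<ge> 1" and "coprime p q" and "k \<ge> 1"
    and "B = {P. rotational_set d p q k P}"
    and "l = (if d - 2 > q * (k - 1) then q * (k - 1) else d - 2)"
  shows "finite B \<and>
    int (card B) =
      (\<Sum>i = k - 1..l. int ((d + q - 2) choose (d - 2 - i)) *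
        (\<Sum>j = 0..k - 1. (- 1) ^ j * int ((k - 1) choose j) * int ((q * (k - 1 - j)) choose i)))"
proof -
  interpret circle_rotation d "p mod q" q k
    using assms(1-5) by unfold_locales (simp_all add: coprime_mod_left_iff)
  have bij: "bij_betw (\<lambda>g. solution (carries g) ` {..<q * k}) {g. admissible g} B"
    using bij_betw_admissible_rotational_sets unfolding assms(6) rotational_set_mod .
  have "{g. admissible g} \<subseteq> multisets_of_size {..q * k} (d - 2)"
    by (auto simp: admissible_def)
  then have "finite {g. admissible g}"
    by (rule finite_subset) (simp add: finite_multisets_of_size)
  then have "finite B"
    using bij_betw_finite[OF bij] by simp
  moreover have "l = min (q * (k - 1)) (d - 2)"
    by (simp add: assms(7))
  ultimately show ?thesis
    using bij_betw_same_card[OF bij] card_admissible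
      alternating_sum_vandermonde[of "k - 1" "d + q - 2" q "d - 2"]
    by (simp add: atLeast0AtMost)
qed

end
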